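(* Let $L\in\mathbb{Z}^d$, $L\ne\mathbf 0$, let $S\subset\mathbb{Z}^d$ be finite, and let $m_0+1$ be the length (number of elements) of the longest thread inside $S$ in the direction $L$, where $m_0\ge 1$. Then the minimal angular directional variance for trigonometric polynomials with coefficient support inside $S$ is $$\min_{p\in\Pi_S}\{\mathrm{var}^A_L(p):\ \|p\|_{\mathbb{T}^d}=1\}=\tan^2\frac{\pi}{m_0+2}.$$ The minimum is attained (up to normalization in $L_2(\mathbb{T}^d)$) by the trigonometric polynomial $p^{\min}$ whose non-zero coefficients are placed on a longest thread $\{k_0,k_0+L,\dots,k_0+m_0L\}$ in $S$ and whose Fourier coefficients $c_k=c_k(p^{\min})$ are $$c_k=\begin{cases}\sin\frac{\pi j}{m_0+2}, & \text{if } k=k_0+(j-1)L,\ j=1,\dots,m_0+1,\\ 0,&\text{otherwise.}\end{cases}$$ The directional uncertainty product of $p^{\min}$ is $$\mathrm{UP}^{\mathbb{T}^d}_L(p^{\min})=\frac{m_0(m_0+4)}{12}\tan^2\frac{\pi}{m_0+2}-\frac12 .$$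
   Context: $\mathbb{T}^d=\mathbb{R}^d/\mathbb{Z}^d$; $\langle\cdot,\cdot\rangle$ and $\|\cdot\|$ on $\mathbb{R}^d$ are the Euclidean inner product and norm; $\|f\|_{\mathbb{T}^d}^2=\int_{\mathbb{T}^d}|f|^2\,dx$ and $\langle f,g\rangle=\int_{\mathbb{T}^d}f\overline{g}\,dx$ on $L_2(\mathbb{T}^d)$. Fourier coefficients: $c_k(f)=\int_{\mathbb{T}^d} f(x)e^{-2\pi i\langle k,x\rangle}\,dx$. For finite $S\subset\mathbb{Z}^d$, $\Pi_S=\{\sum_{k\in S}c_ke^{2\pi i\langle k,x\rangle}:c_k\in\mathbb{C}\}$. A thread inside $S$ (in the direction $L$) is a subset $\{k,k+L,k+2L,\dots,k+mL\}\subseteq S$ with $m\ge0$ an integer such that $k-L\notin S$ and $k+(m+1)L\notin S$. The set $S$ is the disjoint union of its threads. With $\mathcal{A}_Lf(x)=e^{2\pi i\langle L,x\rangle}f(x)$ and $\mathcal{B}_Lf(x)=\frac{i}{2\pi}\sum_{j=1}^dL_j\frac{\partial f}{\partial x_j}(x)$, the angular and frequency directional variances and the directional uncertainty product are $$\mathrm{var}^A_L(f)=\frac{\|f\|_{\mathbb{T}^d}^4}{|\langle\mathcal{A}_Lf,f\rangle|^2}-1,\qquad \mathrm{var}^F_L(f)=\frac{\|\mathcal{B}_Lf\|_{\mathbb{T}^d}^2}{\|f\|_{\mathbb{T}^d}^2}-\frac{|\langle\mathcal{B}_Lf,f\rangle|^2}{\|f\|_{\mathbb{T}^d}^4},\qquad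 \mathrm{UP}^{\mathbb{T}^d}_L(f)=\frac{1}{\|L\|^4}\mathrm{var}^A_L(f)\,\mathrm{var}^F_L(f),$$ with the convention $\mathrm{var}^A_L(f)=\infty$ if $\langle\mathcal{A}_Lf,f\rangle=0$. In Fourier coefficients, $\langle\mathcal{A}_Lf,f\rangle=\sum_{k}c_{k-L}\overline{c_k}$. *)

theory Defs
  imports "HOL-Analysis.Analysis"
begin

definition real_vec :: "int ^ 'd \<Rightarrow> real ^ 'd" where
  "real_vec k = (\<chi> i. real_of_int (k $ i))"

text \<open>
  Functions on the torus are represented by functions on \<open>real ^ 'd\<close>, integrated over the
  unit cube as a fundamental domain (whose boundary is a null set). All functions integrated
  below are periodic whenever the given \<open>f\<close> is.
\<close>

definition torus_integral ::
    "(real ^ 'd \<Rightarrow> 'b) \<Rightarrow> 'b::{banach, second_countable_topology}" where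
  "torus_integral f = set_lebesgue_integral lborel (cbox 0 1) f"

definition torus_norm :: "(real ^ 'd \<Rightarrow> complex) \<Rightarrow> real" where
  "torus_norm f = sqrt (torus_integral (\<lambda>x. (cmod (f x))\<^sup>2))"

definition torus_inner :: "(real ^ 'd \<Rightarrow> complex) \<Rightarrow> (real ^ 'd \<Rightarrow> complex) \<Rightarrow> complex" where
  "torus_inner f g = torus_integral (\<lambda>x. f x * cnj (g x))"

definition harmonic :: "int ^ 'd \<Rightarrow> real ^ 'd \<Rightarrow> complex" where
  "harmonic k x = exp (2 * complex_of_real pi * \<i> * complex_of_real (real_vec k \<bullet> x))"

definition fourier_coeff :: "(real ^ 'd \<Rightarrow> complex) \<Rightarrow> int ^ 'd \<Rightarrow> complex" where
  "fourier_coeff f k =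
     torus_integral (\<lambda>x. f x * exp (- 2 * complex_of_real pi * \<i> * complex_of_real (real_vec k \<bullet> x)))"

definition trig_poly :: "(int ^ 'd) set \<Rightarrow> (real ^ 'd \<Rightarrow> complex) set" where
  "trig_poly S = {p. \<exists>c. p = (\<lambda>x. \<Sum>k\<in>S. c k * harmonic k x)}"

definition progression :: "int ^ 'd \<Rightarrow> int ^ 'd \<Rightarrow> nat \<Rightarrow> (int ^ 'd) set" where
  "progression k L m = (\<lambda>j. k + int j *s L) ` {0..m}"

definition thread :: "(int ^ 'd) set \<Rightarrow> int ^ 'd \<Rightarrow> (int ^ 'd) set \<Rightarrow> bool" where
  "thread S L T \<longleftrightarrow>
     (\<exists>k m. T = progression k L m \<and> T \<subseteq> S \<and> k - L \<notin> S \<and> k + int (m + 1) *s L \<notin> S)"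

definition longest_thread :: "(int ^ 'd) set \<Rightarrow> int ^ 'd \<Rightarrow> (int ^ 'd) set \<Rightarrow> bool" where
  "longest_thread S L T \<longleftrightarrow> thread S L T \<and> (\<forall>T'. thread S L T' \<longrightarrow> card T' \<le> card T)"

definition partial_deriv :: "'d \<Rightarrow> (real ^ 'd \<Rightarrow> complex) \<Rightarrow> real ^ 'd \<Rightarrow> complex" where
  "partial_deriv j f x = vector_derivative (\<lambda>t. f (x + t *\<^sub>R axis j 1)) (at 0)"

definition A_op :: "int ^ 'd \<Rightarrow> (real ^ 'd \<Rightarrow> complex) \<Rightarrow> real ^ 'd \<Rightarrow> complex" where
  "A_op L f x = harmonic L x * f x"

definition B_op :: "int ^ 'd \<Rightarrow> (real ^ 'd \<Rightarrow> complex) \<Rightarrow> real ^ 'd \<Rightarrow> complex" where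
  "B_op L f x =
     \<i> / (2 * complex_of_real pi) * (\<Sum>j\<in>UNIV. of_int (L $ j) * partial_deriv j f x)"

definition var_A :: "int ^ 'd \<Rightarrow> (real ^ 'd \<Rightarrow> complex) \<Rightarrow> ereal" where
  "var_A L f =
     (if torus_inner (A_op L f) f = 0 then \<infinity>
      else ereal (torus_norm f ^ 4 / (cmod (torus_inner (A_op L f) f))\<^sup>2 - 1))"

definition var_F :: "int ^ 'd \<Rightarrow> (real ^ 'd \<Rightarrow> complex) \<Rightarrow> real" where
  "var_F L f =
     (torus_norm (B_op L f))\<^sup>2 / (torus_norm f)\<^sup>2
       - (cmod (torus_inner (B_op L f) f))\<^sup>2 / torus_norm f ^ 4"

definition UP :: "int ^ 'd \<Rightarrow> (real ^ 'd \<Rightarrow> complex) \<Rightarrow> ereal" where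
  "UP L f = ereal (1 / norm (real_vec L) ^ 4) * var_A L f * ereal (var_F L f)"

definition p_min :: "int ^ 'd \<Rightarrow> nat \<Rightarrow> int ^ 'd \<Rightarrow> real ^ 'd \<Rightarrow> complex" where
  "p_min L m\<^sub>0 k\<^sub>0 x =
     (\<Sum>j = 1..m\<^sub>0 + 1.
        complex_of_real (sin (pi * real j / real (m\<^sub>0 + 2))) * harmonic (k\<^sub>0 + int (j - 1) *s L) x)"

end

theory Submission
  imports Defs
begin

text \<open>
  By orthonormality of the harmonics, \<open>\<langle>A\<^sub>L p, p\<rangle> = \<Sum>\<^sub>k c\<^sub>k\<^sub>-\<^sub>L cnj c\<^sub>k\<close>. Let \<open>N = m\<^sub>0 + 2\<close> and let \<open>w k\<close> be the
  sine of \<open>\<pi> j / N\<close>, where \<open>j\<close> is the position of \<open>k\<close> in its thread, and \<open>0\<close> outside \<open>S\<close>. Then \<open>w\<close> is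
  positive on \<open>S\<close> and \<open>w (k - L) + w (k + L) \<le> 2 cos (\<pi> / N) w k\<close>, with equality along a thread of
  maximal length. Weighted AM-GM with weights from \<open>w\<close> gives \<open>|\<langle>A\<^sub>L p, p\<rangle>| \<le> cos (\<pi> / N)\<close> for all
  normalized \<open>p\<close>, hence \<open>var\<^sup>A \<ge> tan\<^sup>2 (\<pi> / N)\<close>, and the sine coefficients attain it. The operator
  \<open>B\<^sub>L\<close> multiplies the \<open>k\<close>-th coefficient by \<open>- \<langle>L, k\<rangle>\<close>, which is affine in the position on a
  thread, so \<open>var\<^sup>F\<close> of the minimizer is \<open>\<parallel>L\<parallel>\<^sup>4\<close> times the variance of \<open>j\<close> under the
  weights \<open>sin\<^sup>2 (\<pi> j / N)\<close>.
\<close>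

section \<open>Trigonometric polynomials on the torus\<close>

lemma integral_unit_interval_exp:
  fixes n :: int
  shows "(\<integral>t. indicator {0..1} t *\<^sub>R exp (2 * complex_of_real pi * \<i> * complex_of_real (of_int n * t)) \<partial>lborel)
    = (if n = 0 then 1 else 0)"
proof (cases "n = 0")
  case False
  let ?a = "2 * complex_of_real pi * \<i> * of_int n"
  have "?a \<noteq> 0" using False by simp
  have "(\<integral>t. indicator {0..1} t *\<^sub>R exp (?a * complex_of_real t) \<partial>lborel)
      = exp (?a * of_real 1) / ?a - exp (?a * of_real 0) / ?a"
  proof (rule integral_FTC_Icc)
    fix x :: real
    have "((\<lambda>z. exp (?a * z) / ?a) has_field_derivative exp (?a * of_real x)) (at (of_real x))"
      using \<open>?a \<noteq> 0\<close> by (auto intro!: derivative_eq_intros)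
    from has_vector_derivative_real_field[OF this]
    show "((\<lambda>t. exp (?a * of_real t) / ?a) has_vector_derivative exp (?a * of_real x))
        (at x within {0..1})" by simp
  qed (auto intro!: continuous_intros)
  also have "\<dots> = 0"
    using exp_integer_2pi[of "of_int n"] by (simp add: mult_ac)
  finally show ?thesis using False by (simp add: mult_ac)
qed simp

text \<open>Fubini: the character and the indicator of the cube both factor over the coordinates,
  and \<open>lborel\<close> is the image of a product of one-dimensional measures. A single nonzero
  entry of \<open>k\<close> kills the product.\<close>

lemma torus_integral_harmonic:
  fixes k :: "int ^ 'd"
  shows "torus_integral (harmonic k) = (if k = 0 then 1 else 0)"
proof -
  let ?e = "\<lambda>b::real^'d. \<lambda>t::real. indicator {0..1} t *\<^sub>R
      exp (2 * complex_of_real pi * \<i> * complex_of_real ((real_vec k \<bullet> b) * t))"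
  interpret product_sigma_finite "\<lambda>_::real^'d. lborel :: real measure" ..
  have int: "integrable lborel (?e b)" for b
    by (intro borel_integrable_compact compact_Icc continuous_intros)
  have "(1 :: real^'d) \<bullet> b = 1" if "b \<in> Basis" for b
    using that by (auto simp: Basis_vec_def inner_axis)
  then have ind: "indicator (cbox 0 1) x = (\<Prod>b\<in>Basis. indicator {0..1} (x \<bullet> b) :: real)" for x :: "real^'d"
    by (auto simp: indicator_def mem_box)
  have "harmonic k x = (\<Prod>b\<in>Basis. exp (2 * complex_of_real pi * \<i> * complex_of_real ((real_vec k \<bullet> b) * (x \<bullet> b))))" for x
    unfolding harmonic_def
    by (subst euclidean_inner) (simp add: exp_sum sum_distrib_left)
  then have "indicator (cbox 0 1) x *\<^sub>R harmonic k x = (\<Prod>b\<in>Basis. ?e b (x \<bullet> b))" for x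
    by (simp add: ind scaleR_conv_of_real prod.distrib)
  then have "torus_integral (harmonic k) = (\<integral>x. (\<Prod>b\<in>Basis. ?e b (x \<bullet> b)) \<partial>lborel)"
    by (simp add: torus_integral_def set_lebesgue_integral_def)
  also have "\<dots> = (\<integral>f. (\<Prod>b\<in>Basis. ?e b (f b)) \<partial>(\<Pi>\<^sub>M b\<in>Basis. lborel))"
    by (subst lborel_eq, subst integral_distr) simp_all
  also have "\<dots> = (\<Prod>b\<in>Basis. \<integral>t. ?e b t \<partial>lborel)"
    by (rule product_integral_prod) (use int in auto)
  also have "\<dots> = (\<Prod>i\<in>UNIV. \<integral>t. ?e (axis i 1) t \<partial>lborel)"
    unfolding Basis_vec_def
    by (rule prod.reindex_cong[of "\<lambda>i. axis i 1"]) (auto simp: inj_on_def axis_eq_axis)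
  also have "\<dots> = (\<Prod>i\<in>UNIV. if k $ i = 0 then 1 else 0)"
    by (intro prod.cong refl, subst integral_unit_interval_exp[symmetric])
       (simp add: real_vec_def inner_axis)
  also have "\<dots> = (if k = 0 then 1 else 0)"
    by (auto simp: vec_eq_iff)
  finally show ?thesis .
qed

text \<open>Frequencies come from an index map, possibly not injective: products (indexed by pairs),
  shifts by \<open>A_op\<close> and sums along a thread then all keep this form.\<close>

definition trig_sum :: "('i \<Rightarrow> int ^ 'd) \<Rightarrow> ('i \<Rightarrow> complex) \<Rightarrow> 'i set \<Rightarrow> real ^ 'd \<Rightarrow> complex" where
  "trig_sum \<kappa> c I x = (\<Sum>i\<in>I. c i * harmonic (\<kappa> i) x)"

lemma real_vec_add: "real_vec (k + l) = real_vec k + real_vec l"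
  and real_vec_uminus: "real_vec (- k) = - real_vec k"
  by (simp_all add: real_vec_def vec_eq_iff)

lemma harmonic_add: "harmonic (k + l) x = harmonic k x * harmonic l x"
  by (simp add: harmonic_def real_vec_add inner_add_left distrib_left exp_add)

lemma cnj_harmonic: "cnj (harmonic k x) = harmonic (- k) x"
  by (simp add: harmonic_def real_vec_uminus exp_cnj)

lemma continuous_on_harmonic [continuous_intros]: "continuous_on A (harmonic k)"
  unfolding harmonic_def[abs_def] by (intro continuous_intros)

lemma torus_integral_trig_sum:
  assumes "finite I"
  shows "torus_integral (trig_sum \<kappa> c I) = (\<Sum>i\<in>I. if \<kappa> i = 0 then c i else 0)"
proof -
  have "integrable lborel (\<lambda>x. indicator (cbox 0 1) x *\<^sub>R (c i * harmonic (\<kappa> i) x))" for i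
    by (intro borel_integrable_compact compact_cbox continuous_intros)
  then have "torus_integral (trig_sum \<kappa> c I) = (\<Sum>i\<in>I. torus_integral (\<lambda>x. c i * harmonic (\<kappa> i) x))"
    unfolding torus_integral_def trig_sum_def[abs_def] set_lebesgue_integral_def scaleR_sum_right
    by (rule Bochner_Integration.integral_sum)
  also have "\<dots> = (\<Sum>i\<in>I. c i * torus_integral (harmonic (\<kappa> i)))"
    by (simp add: torus_integral_def)
  finally show ?thesis by (simp add: torus_integral_harmonic if_distrib cong: if_cong)
qed

text \<open>One sum times the conjugate of the other is a sum over pairs whose frequencies are the
  differences; only zero differences survive integration.\<close>

lemma torus_inner_trig_sum:
  assumes "finite I" "finite J"
  shows "torus_inner (trig_sum \<kappa> c I) (trig_sum \<mu> d J)
    = (\<Sum>i\<in>I. \<Sum>j\<in>J. if \<kappa> i = \<mu> j then c i * cnj (d j) else 0)"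
proof -
  have "(\<lambda>x. trig_sum \<kappa> c I x * cnj (trig_sum \<mu> d J x))
      = trig_sum (\<lambda>(i, j). \<kappa> i - \<mu> j) (\<lambda>(i, j). c i * cnj (d j)) (I \<times> J)"
  proof
    fix x
    have "harmonic (\<kappa> i - \<mu> j) x = harmonic (\<kappa> i) x * cnj (harmonic (\<mu> j) x)" for i j
      using harmonic_add[of "\<kappa> i" "- \<mu> j" x] by (simp add: cnj_harmonic)
    then show "trig_sum \<kappa> c I x * cnj (trig_sum \<mu> d J x)
      = trig_sum (\<lambda>(i, j). \<kappa> i - \<mu> j) (\<lambda>(i, j). c i * cnj (d j)) (I \<times> J) x"
      by (simp add: trig_sum_def sum_product sum.cartesian_product split_def mult_ac)
  qed
  then show ?thesis
    using assms
    by (simp add: torus_inner_def torus_integral_trig_sum sum.cartesian_product split_def)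
qed

lemma of_real_torus_norm_squared:
  "complex_of_real ((torus_norm f)\<^sup>2) = torus_inner f f"
proof -
  have "torus_integral (\<lambda>x. (cmod (f x))\<^sup>2) \<ge> 0"
    unfolding torus_integral_def set_lebesgue_integral_def by (rule integral_nonneg_AE) simp
  then show ?thesis
    unfolding torus_norm_def torus_inner_def torus_integral_def complex_norm_square[symmetric]
      set_integral_complex_of_real
    by simp
qed

section \<open>Operators, Fourier coefficients and norms of trigonometric sums\<close>

lemma A_op_trig_sum: "A_op L (trig_sum \<kappa> c I) = trig_sum (\<lambda>i. L + \<kappa> i) c I"
  by (simp add: fun_eq_iff A_op_def trig_sum_def harmonic_add sum_distrib_left mult_ac)

lemma partial_deriv_trig_sum:
  "partial_deriv j (trig_sum \<kappa> c I) = trig_sum \<kappa> (\<lambda>i. 2 * of_real pi * \<i> * of_int (\<kappa> i $ j) * c i) I"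
proof
  fix x
  have "((\<lambda>t. harmonic k (x + t *\<^sub>R axis j 1)) has_vector_derivative
      2 * of_real pi * \<i> * of_int (k $ j) * harmonic k x) (at 0)" for k
  proof -
    let ?a = "2 * complex_of_real pi * \<i>"
    \<comment> \<open>Along the \<open>j\<close>-th axis the harmonic is its value at
      \<open>x\<close> times an exponential in \<open>t\<close>, which extends holomorphically; the
      complex derivative restricts to the real line.\<close>
    have "((\<lambda>z. exp (?a * of_int (k $ j) * z) * harmonic k x) has_field_derivative
        ?a * of_int (k $ j) * harmonic k x) (at (of_real 0))"
      by (auto intro!: derivative_eq_intros)
    from has_vector_derivative_real_field[OF this]
    show ?thesis
      by (simp add: harmonic_def inner_add_right inner_axis real_vec_def distrib_left exp_add mult_ac)
  qed
  then have "((\<lambda>t. \<Sum>i\<in>I. c i * harmonic (\<kappa> i) (x + t *\<^sub>R axis j 1)) has_vector_derivative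
     (\<Sum>i\<in>I. c i * (2 * of_real pi * \<i> * of_int (\<kappa> i $ j) * harmonic (\<kappa> i) x))) (at 0)"
    by (intro has_vector_derivative_sum has_vector_derivative_mult_right)
  then show "partial_deriv j (trig_sum \<kappa> c I) x
      = trig_sum \<kappa> (\<lambda>i. 2 * of_real pi * \<i> * of_int (\<kappa> i $ j) * c i) I x"
    by (simp add: partial_deriv_def trig_sum_def vector_derivative_at mult_ac)
qed

text \<open>Each partial derivative brings down \<open>2 pi i\<close> times a frequency entry; the
  prefactor \<open>i / (2 pi)\<close> turns this into a real eigenvalue with a minus sign.\<close>

lemma B_op_trig_sum:
  "B_op L (trig_sum \<kappa> c I) = trig_sum \<kappa> (\<lambda>i. - of_real (real_vec L \<bullet> real_vec (\<kappa> i)) * c i) I"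
proof
  fix x
  have "B_op L (trig_sum \<kappa> c I) x = (\<Sum>j\<in>UNIV. \<Sum>i\<in>I. - of_int (L $ j) * of_int (\<kappa> i $ j) * (c i * harmonic (\<kappa> i) x))"
    by (simp add: B_op_def partial_deriv_trig_sum trig_sum_def sum_distrib_left mult_ac)
  also have "\<dots> = (\<Sum>i\<in>I. \<Sum>j\<in>UNIV. - of_int (L $ j) * of_int (\<kappa> i $ j) * (c i * harmonic (\<kappa> i) x))"
    by (rule sum.swap)
  also have "\<dots> = trig_sum \<kappa> (\<lambda>i. - of_real (real_vec L \<bullet> real_vec (\<kappa> i)) * c i) I x"
    by (simp add: trig_sum_def inner_vec_def real_vec_def sum_distrib_left sum_negf mult_ac)
  finally show "B_op L (trig_sum \<kappa> c I) x = trig_sum \<kappa> (\<lambda>i. - of_real (real_vec L \<bullet> real_vec (\<kappa> i)) * c i) I x" .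
qed

lemma fourier_coeff_trig_sum:
  assumes "finite I"
  shows "fourier_coeff (trig_sum \<kappa> c I) k = (\<Sum>i | i \<in> I \<and> \<kappa> i = k. c i)"
proof -
  \<comment> \<open>A coefficient is the inner product with a single harmonic, written as a
    \<open>trig_sum\<close> over a one-point index set.\<close>
  have "fourier_coeff (trig_sum \<kappa> c I) k = torus_inner (trig_sum \<kappa> c I) (trig_sum (\<lambda>_. k) (\<lambda>_. 1) {()})"
    by (simp add: fourier_coeff_def torus_inner_def trig_sum_def harmonic_def exp_cnj)
  also have "\<dots> = (\<Sum>i\<in>I. if \<kappa> i = k then c i else 0)"
    using assms by (simp add: torus_inner_trig_sum cong: if_cong)
  finally show ?thesis using assms by (simp add: sum.inter_filter)
qed

lemma trig_sum_in_trig_poly: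
  assumes "finite I" "finite S" "\<kappa> ` I \<subseteq> S"
  shows "trig_sum \<kappa> c I \<in> trig_poly S"
proof -
  have "trig_sum \<kappa> c I x = (\<Sum>k\<in>S. (\<Sum>i | i \<in> I \<and> \<kappa> i = k. c i) * harmonic k x)" for x
    using assms unfolding trig_sum_def
    by (subst sum.group[of I S \<kappa>, symmetric]) (auto simp: sum_distrib_right intro!: sum.cong)
  then show ?thesis by (auto simp: trig_poly_def fun_eq_iff)
qed

lemma torus_inner_trig_sum_same:
  assumes "finite I" "inj_on \<kappa> I"
  shows "torus_inner (trig_sum \<kappa> c I) (trig_sum \<kappa> d I) = (\<Sum>i\<in>I. c i * cnj (d i))"
proof -
  have "(\<Sum>j\<in>I. if \<kappa> i = \<kappa> j then c i * cnj (d j) else 0) = c i * cnj (d i)" if "i \<in> I" for i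
  proof -
    have "(\<Sum>j\<in>I. if \<kappa> i = \<kappa> j then c i * cnj (d j) else 0) = (\<Sum>j\<in>I. if j = i then c i * cnj (d j) else 0)"
      using assms(2) that by (intro sum.cong) (auto simp: inj_on_def)
    then show ?thesis using assms(1) that by simp
  qed
  then show ?thesis using assms by (simp add: torus_inner_trig_sum)
qed

lemma torus_norm_trig_sum:
  assumes "finite I" "inj_on \<kappa> I"
  shows "(torus_norm (trig_sum \<kappa> c I))\<^sup>2 = (\<Sum>i\<in>I. (cmod (c i))\<^sup>2)"
proof -
  have "complex_of_real ((torus_norm (trig_sum \<kappa> c I))\<^sup>2) = of_real (\<Sum>i\<in>I. (cmod (c i))\<^sup>2)"
    unfolding of_real_torus_norm_squared torus_inner_trig_sum_same[OF assms] of_real_sum complex_norm_square ..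
  then show ?thesis by (simp only: of_real_eq_iff)
qed

section \<open>The lower bound\<close>

text \<open>The position of \<open>k\<close> in its thread, counted from \<open>1\<close>, and \<open>0\<close> if \<open>k\<close> is not in \<open>S\<close>.\<close>

definition thread_index :: "(int ^ 'd) set \<Rightarrow> int ^ 'd \<Rightarrow> int ^ 'd \<Rightarrow> nat" where
  "thread_index S L k = (LEAST j. k - int j *s L \<notin> S)"

lemma int_scale_right_inject:
  fixes L :: "int ^ 'd"
  assumes "L \<noteq> 0"
  shows "a *s L = b *s L \<longleftrightarrow> a = b"
  using assms by (auto simp: vec_eq_iff)

text \<open>A ray has infinitely many distinct points. Applied to \<open>- L\<close>, this also
  yields the backward exits that make \<open>thread_index\<close> well defined.\<close>

lemma ray_exits:
  fixes L :: "int ^ 'd"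
  assumes "finite S" "L \<noteq> 0"
  shows "\<exists>j. k + int j *s L \<notin> S"
proof (rule ccontr)
  assume "\<not> ?thesis"
  then have "range (\<lambda>j. k + int j *s L) \<subseteq> S" by auto
  moreover have "inj (\<lambda>j. k + int j *s L)"
    using assms(2) by (auto simp: inj_def int_scale_right_inject)
  ultimately show False
    using assms(1) by (meson finite_imageD finite_subset infinite_UNIV_nat)
qed

lemma card_progression:
  fixes L :: "int ^ 'd"
  assumes "L \<noteq> 0"
  shows "card (progression k L m) = Suc m"
  unfolding progression_def
  using assms by (subst card_image) (auto simp: inj_on_def int_scale_right_inject)

text \<open>Extending \<open>k\<close> in \<open>S\<close> both ways until \<open>S\<close> is left
  produces a thread; its part up to and including \<open>k\<close> already has
  \<open>thread_index S L k\<close> elements.\<close>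

lemma thread_index_le:
  fixes L :: "int ^ 'd"
  assumes "finite S" "L \<noteq> 0" and max: "\<And>T. thread S L T \<Longrightarrow> card T \<le> m"
  shows "thread_index S L k \<le> m"
proof (cases "k \<in> S")
  case True
  let ?p = "thread_index S L k"
  define q where "q = (LEAST j. k + int j *s L \<notin> S)"
  have q: "k + int q *s L \<notin> S"
    unfolding q_def by (rule LeastI_ex) (rule ray_exits[OF assms(1,2)])
  have q': "k + int j *s L \<in> S" if "j < q" for j
    using not_less_Least[OF that[unfolded q_def]] by simp
  have p: "k - int ?p *s L \<notin> S"
    unfolding thread_index_def
    by (rule LeastI_ex) (use ray_exits[of S "- L" k] assms(1,2) in simp)
  have p': "k - int j *s L \<in> S" if "j < ?p" for j
    using not_less_Least[OF that[unfolded thread_index_def]] by simp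
  have "q > 0" "?p > 0" using p q True by (auto intro: ccontr)
  \<comment> \<open>There are \<open>?p\<close> points from \<open>k\<close> backwards and
    \<open>q\<close> points from \<open>k\<close> forwards. As \<open>k\<close> is counted twice,
    the thread has \<open>?p + q - 1\<close> points and last index
    \<open>?p + q - 2\<close>.\<close>
  let ?b = "k - int (?p - 1) *s L" and ?m = "?p + q - 2"
  have "thread S L (progression ?b L ?m)"
    unfolding thread_def
  proof (intro exI conjI)
    show "progression ?b L ?m \<subseteq> S"
    proof
      fix x assume "x \<in> progression ?b L ?m"
      then obtain j where x: "x = ?b + int j *s L" and "j \<le> ?m"
        by (auto simp: progression_def)
      show "x \<in> S"
      proof (cases "j < ?p")
        case True
        then have "?b + int j *s L = k - int (?p - 1 - j) *s L"
          by (simp add: vec_eq_iff algebra_simps of_nat_diff)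
        then show ?thesis using p'[of "?p - 1 - j"] \<open>?p > 0\<close> by (simp only: x)
      next
        case False
        then have "?b + int j *s L = k + int (j - (?p - 1)) *s L"
          by (simp add: vec_eq_iff algebra_simps of_nat_diff)
        then show ?thesis using q'[of "j - (?p - 1)"] \<open>?p > 0\<close> \<open>q > 0\<close> \<open>j \<le> ?m\<close> False by (simp only: x)
      qed
    qed
    have "?b - L = k - int ?p *s L"
      using \<open>?p > 0\<close> by (simp add: vec_eq_iff algebra_simps of_nat_diff)
    then show "?b - L \<notin> S" using p by (simp only: not_False_eq_True)
    have "?b + int (?m + 1) *s L = k + int q *s L"
      using \<open>?p > 0\<close> \<open>q > 0\<close> by (simp add: vec_eq_iff algebra_simps of_nat_diff)
    then show "?b + int (?m + 1) *s L \<notin> S" using q by (simp only: not_False_eq_True)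
  qed (rule refl)
  from max[OF this] show ?thesis
    using \<open>q > 0\<close> \<open>?p > 0\<close> by (simp add: card_progression assms)
next
  case False
  then show ?thesis by (simp add: thread_index_def)
qed

lemma thread_index_eq_0_iff:
  fixes L :: "int ^ 'd"
  assumes "finite S" "L \<noteq> 0"
  shows "thread_index S L k = 0 \<longleftrightarrow> k \<notin> S"
proof -
  obtain j where "k - int j *s L \<notin> S"
    using ray_exits[of S "- L" k] assms by auto
  from LeastI[of "\<lambda>j. k - int j *s L \<notin> S", OF this] show ?thesis
    unfolding thread_index_def by (auto intro: Least_eq_0)
qed

text \<open>The recursion includes the start of a thread: there \<open>k - L\<close> lies outside
  \<open>S\<close> and has index 0.\<close>

lemma thread_index_step:
  fixes L :: "int ^ 'd"
  assumes "finite S" "L \<noteq> 0" "k \<in> S"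
  shows "thread_index S L k = Suc (thread_index S L (k - L))"
proof -
  obtain j where "k - int j *s L \<notin> S"
    using ray_exits[of S "- L" k] assms by auto
  then have "thread_index S L k = Suc (LEAST j. k - int (Suc j) *s L \<notin> S)"
    unfolding thread_index_def by (rule Least_Suc) (use assms in simp)
  moreover have "k - int (Suc j) *s L = k - L - int j *s L" for j
    by (simp add: vec_eq_iff algebra_simps)
  ultimately show ?thesis by (simp only: thread_index_def)
qed

section \<open>Bounding the shift form\<close>

text \<open>AM-GM on each product, with weights \<open>w\<close>, turns the shift form into a diagonal one; the best
  constant comes from a positive \<open>w\<close> that is a supersolution of the eigenvalue equation of the shift.\<close>

lemma shift_form_bound:
  fixes a w :: "'a::ab_group_add \<Rightarrow> real"
  assumes "finite S"
    and w_pos: "\<And>k. k \<in> S \<Longrightarrow> w k > 0" and w_0: "\<And>k. k \<notin> S \<Longrightarrow> w k = 0"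
    and super: "\<And>k. k \<in> S \<Longrightarrow> w (k - L) + w (k + L) \<le> 2 * r * w k"
    and a_nonneg: "\<And>k. a k \<ge> 0" and a_0: "\<And>k. k \<notin> S \<Longrightarrow> a k = 0"
  shows "(\<Sum>k\<in>S. a (k - L) * a k) \<le> r * (\<Sum>k\<in>S. (a k)\<^sup>2)"
proof -
  have amgm: "2 * (a (k - L) * a k) \<le> w k / w (k - L) * (a (k - L))\<^sup>2 + w (k - L) / w k * (a k)\<^sup>2"
    if "k \<in> S" for k
  proof (cases "k - L \<in> S")
    case True
    then have w: "w k > 0" "w (k - L) > 0" using w_pos that by auto
    \<comment> \<open>The difference of the two sides is a perfect square over a positive
      product.\<close>
    have "0 \<le> (w k * a (k - L) - w (k - L) * a k)\<^sup>2 / (w k * w (k - L))" using w by simp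
    also have "\<dots> = w k / w (k - L) * (a (k - L))\<^sup>2 + w (k - L) / w k * (a k)\<^sup>2 - 2 * (a (k - L) * a k)"
      using w by (simp add: field_simps power2_eq_square)
    finally show ?thesis by simp
  qed (simp add: a_0 w_0)
  \<comment> \<open>Substituting \<open>k + L\<close> for \<open>k\<close> moves the weight onto
    \<open>(a k)\<^sup>2\<close>. The boundary terms vanish on the left because \<open>a\<close> is
    0 outside \<open>S\<close>, on the right because \<open>w\<close> is.\<close>
  have "(\<Sum>k\<in>S. w k / w (k - L) * (a (k - L))\<^sup>2)
      = (\<Sum>k\<in>{k\<in>S. k - L \<in> S}. w k / w (k - L) * (a (k - L))\<^sup>2)"
    using assms(1) by (intro sum.mono_neutral_right) (auto simp: a_0)
  also have "\<dots> = (\<Sum>k\<in>{k\<in>S. k + L \<in> S}. w (k + L) / w k * (a k)\<^sup>2)"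
    by (rule sum.reindex_bij_witness[of _ "\<lambda>k. k + L" "\<lambda>k. k - L"]) auto
  also have "\<dots> = (\<Sum>k\<in>S. w (k + L) / w k * (a k)\<^sup>2)"
    using assms(1) by (intro sum.mono_neutral_left) (auto simp: w_0)
  finally have shift: "(\<Sum>k\<in>S. w k / w (k - L) * (a (k - L))\<^sup>2) = (\<Sum>k\<in>S. w (k + L) / w k * (a k)\<^sup>2)" .
  have "2 * (\<Sum>k\<in>S. a (k - L) * a k)
      \<le> (\<Sum>k\<in>S. w k / w (k - L) * (a (k - L))\<^sup>2 + w (k - L) / w k * (a k)\<^sup>2)"
    unfolding sum_distrib_left by (intro sum_mono amgm)
  also have "\<dots> = (\<Sum>k\<in>S. (w (k - L) + w (k + L)) / w k * (a k)\<^sup>2)"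
    unfolding sum.distrib shift by (simp add: add_divide_distrib distrib_right sum.distrib)
  also have "\<dots> \<le> (\<Sum>k\<in>S. 2 * r * (a k)\<^sup>2)"
    using super w_pos by (intro sum_mono mult_right_mono) (auto simp: pos_divide_le_eq)
  finally show ?thesis by (simp add: sum_distrib_left[symmetric] mult.assoc)
qed

text \<open>The angle \<open>t = pi / (m + 1)\<close> is chosen so that \<open>sin (j t)\<close> is
  positive at all positions from 1 to \<open>m\<close> and vanishes at \<open>m + 1\<close>, one
  step past the largest possible position.\<close>

lemma thread_shift_bound:
  fixes L :: "int ^ 'd"
  assumes S: "finite S" "L \<noteq> 0" and max: "\<And>T. thread S L T \<Longrightarrow> card T \<le> m"
    and a_nonneg: "\<And>k. a k \<ge> 0" and a_0: "\<And>k. k \<notin> S \<Longrightarrow> a k = 0"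
  shows "(\<Sum>k\<in>S. a (k - L) * a k) \<le> cos (pi / real (m + 1)) * (\<Sum>k\<in>S. (a k)\<^sup>2)"
proof -
  define t where "t = pi / real (m + 1)"
  define w where "w k = sin (real (thread_index S L k) * t)" for k
  have pos: "sin (real j * t) > 0" if "0 < j" "j \<le> m" for j
  proof (rule sin_gt_zero)
    have "pi * real j < pi * real (m + 1)" using that by simp
    then show "real j * t < pi" by (simp add: t_def field_simps)
  qed (use that in \<open>simp add: t_def\<close>)
  have sin_end: "sin (real (Suc m) * t) = 0" by (simp add: t_def)
  have le: "thread_index S L k \<le> m" for k
    using thread_index_le[OF S max] .
  show ?thesis
    unfolding t_def[symmetric]
  proof (rule shift_form_bound[where w = w, OF S(1) _ _ _ a_nonneg a_0])
    fix k assume "k \<in> S"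
    then have 0: "thread_index S L k > 0" using thread_index_eq_0_iff[OF S, of k] by simp
    then show "w k > 0" unfolding w_def using pos le by simp
    have minus: "w (k - L) = sin (real (thread_index S L k) * t - t)"
      unfolding w_def thread_index_step[OF S \<open>k \<in> S\<close>] by (simp add: algebra_simps)
    \<comment> \<open>At the end of a thread \<open>w (k + L)\<close> is 0, while the continued sine
      is still nonnegative since the next position is at most \<open>m + 1\<close>. The inequality
      is strict there for threads with fewer than \<open>m\<close> elements.\<close>
    have plus: "w (k + L) \<le> sin (real (thread_index S L k) * t + t)"
    proof (cases "k + L \<in> S")
      case True
      then show ?thesis
        unfolding w_def using thread_index_step[OF S True] by (simp add: algebra_simps)
    next
      case False
      have "sin (real (Suc (thread_index S L k)) * t) \<ge> 0"
      proof (cases "thread_index S L k = m")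
        case False
        then show ?thesis using pos[of "Suc (thread_index S L k)"] le[of k] by simp
      qed (simp add: sin_end del: of_nat_Suc)
      then show ?thesis
        using False thread_index_eq_0_iff[OF S, of "k + L"] by (simp add: w_def algebra_simps)
    qed
    show "w (k - L) + w (k + L) \<le> 2 * cos t * w k"
      using minus plus unfolding sin_add sin_diff w_def by (simp add: mult_ac)
  next
    fix k assume "k \<notin> S"
    then show "w k = 0" unfolding w_def using thread_index_eq_0_iff[OF S, of k] by simp
  qed
qed

lemma var_A_lower_bound:
  fixes L :: "int ^ 'd"
  assumes S: "finite S" "L \<noteq> 0" and max: "\<And>T. thread S L T \<Longrightarrow> card T \<le> m" and "m \<ge> 2"
    and p: "p \<in> trig_poly S" "torus_norm p = 1"
  shows "ereal ((tan (pi / real (m + 1)))\<^sup>2) \<le> var_A L p"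
proof -
  obtain b where "p = (\<lambda>x. \<Sum>k\<in>S. b k * harmonic k x)"
    using p(1) by (auto simp: trig_poly_def)
  \<comment> \<open>Cutting the coefficients off outside \<open>S\<close> lets
    \<open>c (l - L)\<close> vanish when \<open>l - L\<close> leaves \<open>S\<close>.\<close>
  moreover define c where "c k = (if k \<in> S then b k else 0)" for k
  ultimately have p_eq: "p = trig_sum (\<lambda>k. k) c S"
    by (simp add: fun_eq_iff trig_sum_def)
  define z where "z = torus_inner (A_op L p) p"
  have "z = (\<Sum>k\<in>S. \<Sum>l\<in>S. if L + k = l then c k * cnj (c l) else 0)"
    by (simp add: z_def p_eq A_op_trig_sum torus_inner_trig_sum S)
  also have "\<dots> = (\<Sum>l\<in>S. \<Sum>k\<in>S. if k = l - L then c k * cnj (c l) else 0)"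
    by (subst sum.swap) (auto intro!: sum.cong simp: algebra_simps)
  also have "\<dots> = (\<Sum>l\<in>S. c (l - L) * cnj (c l))"
    using S by (intro sum.cong) (auto simp: c_def)
  finally have "cmod z \<le> (\<Sum>l\<in>S. cmod (c (l - L)) * cmod (c l))"
    by (simp add: norm_mult sum_norm_le)
  also have "\<dots> \<le> cos (pi / real (m + 1)) * (\<Sum>k\<in>S. (cmod (c k))\<^sup>2)"
    by (rule thread_shift_bound[OF S max]) (auto simp: c_def)
  also have "(\<Sum>k\<in>S. (cmod (c k))\<^sup>2) = 1"
    using torus_norm_trig_sum[of S "\<lambda>k. k" c] p(2) S by (simp add: p_eq)
  finally have z_le: "cmod z \<le> cos (pi / real (m + 1))" by simp
  show ?thesis
  proof (cases "z = 0")
    case False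
    let ?t = "pi / real (m + 1)"
    have "1 / (cos ?t)\<^sup>2 \<le> 1 / (cmod z)\<^sup>2"
      using z_le False by (intro divide_left_mono power_mono) (auto intro!: mult_pos_pos)
    \<comment> \<open>Positivity is read off from the bound just proved, as \<open>z\<close> is
      nonzero.\<close>
    moreover have "cos ?t > 0" using z_le False by (smt (verit) zero_less_norm_iff)
    then have "(tan ?t)\<^sup>2 = 1 / (cos ?t)\<^sup>2 - 1"
      using tan_sec[of ?t] by (simp add: inverse_eq_divide power_divide)
    ultimately show ?thesis
      using False p(2) by (simp add: var_A_def z_def[symmetric])
  qed (simp add: var_A_def z_def[symmetric])
qed

section \<open>The minimizer\<close>

text \<open>A discrete antiderivative: the right-hand side is found by the ansatz of a combination of
  \<open>sin ((2n - 1)t)\<close> and \<open>cos ((2n - 1)t)\<close> with quadratic coefficients in \<open>n\<close>.\<close>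

lemma sum_square_cos_double_angle:
  fixes t :: real
  shows "4 * sin t ^ 3 * (\<Sum>j<n. (real j)\<^sup>2 * cos (2 * real j * t))
    = (2 * (real n * (real n - 1)) * (sin t)\<^sup>2 - (cos t)\<^sup>2) * sin ((2 * real n - 1) * t)
      + sin t * cos t * (2 * real n - 1) * cos ((2 * real n - 1) * t)"
proof (induction n)
  case 0
  show ?case by (simp add: power2_eq_square)
next
  case (Suc n)
  define x where "x = 2 * real n * t"
  have e: "(2 * real n - 1) * t = x - t" "(2 * real (Suc n) - 1) * t = x + t"
    by (simp_all add: x_def algebra_simps)
  show ?case
    unfolding sum.lessThan_Suc distrib_left Suc.IH e sin_add cos_add sin_diff cos_diff
    unfolding x_def[symmetric] of_nat_Suc
    by (simp add: algebra_simps power2_eq_square power3_eq_cube)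
qed

text \<open>Telescoping: \<open>2 sin t cos (2jt) = sin ((2j + 1)t) - sin ((2j - 1)t)\<close>; the
  lower end \<open>j = 0\<close> leaves \<open>+ sin t\<close>.\<close>

lemma sum_cos_double_angle:
  fixes t :: real
  shows "2 * sin t * (\<Sum>j<n. cos (2 * real j * t)) = sin ((2 * real n - 1) * t) + sin t"
proof (induction n)
  case (Suc n)
  define x where "x = 2 * real n * t"
  have e: "(2 * real n - 1) * t = x - t" "(2 * real (Suc n) - 1) * t = x + t"
    by (simp_all add: x_def algebra_simps)
  show ?case
    unfolding sum.lessThan_Suc distrib_left Suc.IH e sin_add sin_diff
    by (simp add: x_def)
qed simp

context
  fixes N :: nat and t :: real
  assumes N: "N \<ge> 2" and t: "t = pi / real N"
begin

lemma sin_step_pos: "sin t > 0"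
  using N unfolding t by (intro sin_gt_zero) (auto simp: field_simps)

text \<open>Both closed forms above are used at \<open>n = N\<close>, where this reduces their angle
  to \<open>t\<close>.\<close>

lemma last_angle: "(2 * real N - 1) * t = 2 * pi - t"
  using N by (simp add: t field_simps)

lemma sum_sin_squared: "(\<Sum>j<N. (sin (real j * t))\<^sup>2) = real N / 2"
proof -
  have "2 * sin t * (\<Sum>j<N. cos (2 * real j * t)) = 0"
    unfolding sum_cos_double_angle last_angle by (simp add: sin_diff)
  then have z: "(\<Sum>j<N. cos (2 * real j * t)) = 0"
    using sin_step_pos by simp
  have "(sin (real j * t))\<^sup>2 = 1/2 - cos (2 * real j * t) / 2" for j
    using cos_double_sin[of "real j * t"] by (simp add: mult.assoc diff_divide_distrib)
  then show ?thesis using z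
    by (simp add: sum_subtractf flip: sum_divide_distrib)
qed

text \<open>The half-angle formula splits this second moment into the sum of squares and the cosine
  sum \<open>?C\<close>; \<open>sin t > 0\<close> permits cancelling the cube in the closed form for
  \<open>?C\<close>.\<close>

lemma sum_square_times_sin_squared:
  "(\<Sum>j<N. (real j)\<^sup>2 * (sin (real j * t))\<^sup>2)
     = real N / 2 * (((real N)\<^sup>2 - 1) / 3 - (cos t / sin t)\<^sup>2 / 2)"
proof -
  let ?C = "\<Sum>j<N. (real j)\<^sup>2 * cos (2 * real j * t)"
  have "4 * sin t ^ 3 * ?C = - ((2 * (real N * (real N - 1)) * (sin t)\<^sup>2 - (cos t)\<^sup>2) * sin t)
      + sin t * cos t * (2 * real N - 1) * cos t"
    unfolding sum_square_cos_double_angle last_angle by (simp add: sin_diff cos_diff)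
  also have "\<dots> = 2 * sin t ^ 3 * (real N * (1 - real N) + real N * (cos t / sin t)\<^sup>2)"
    using sin_step_pos by (simp add: field_simps power2_eq_square power3_eq_cube)
  finally have C: "2 * ?C = real N * (1 - real N) + real N * (cos t / sin t)\<^sup>2"
    using sin_step_pos by simp
  have sq: "6 * (\<Sum>j<n. (real j)\<^sup>2) = (real n - 1) * real n * (2 * real n - 1)" for n
    by (induction n) (auto simp: algebra_simps power2_eq_square)
  have sin_sq: "(sin (real j * t))\<^sup>2 = 1/2 - cos (2 * real j * t) / 2" for j
    using cos_double_sin[of "real j * t"] by (simp add: mult.assoc diff_divide_distrib)
  have "(real j)\<^sup>2 * (sin (real j * t))\<^sup>2 = (real j)\<^sup>2 / 2 - (real j)\<^sup>2 * cos (2 * real j * t) / 2" for j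
    unfolding sin_sq by (simp add: algebra_simps)
  then have "(\<Sum>j<N. (real j)\<^sup>2 * (sin (real j * t))\<^sup>2) = (\<Sum>j<N. (real j)\<^sup>2) / 2 - ?C / 2"
    by (simp add: sum_subtractf sum_divide_distrib)
  also have "\<dots> = (real N - 1) * real N * (2 * real N - 1) / 12
      - (real N * (1 - real N) + real N * (cos t / sin t)\<^sup>2) / 4"
  proof -
    have "(\<Sum>j<N. (real j)\<^sup>2) = (real N - 1) * real N * (2 * real N - 1) / 6"
      using sq[of N] by simp
    moreover have "?C = (real N * (1 - real N) + real N * (cos t / sin t)\<^sup>2) / 2"
      using C by simp
    ultimately show ?thesis by (simp only: divide_divide_eq_left)
  qed
  also have "\<dots> = real N / 2 * (((real N)\<^sup>2 - 1) / 3 - (cos t / sin t)\<^sup>2 / 2)"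
    by (simp add: field_simps power2_eq_square)
  finally show ?thesis .
qed

text \<open>The weights are symmetric under \<open>j\<close> to \<open>N - j\<close>, so the mean
  position is \<open>N / 2\<close>.\<close>

lemma sum_times_sin_squared: "(\<Sum>j<N. real j * (sin (real j * t))\<^sup>2) = (real N)\<^sup>2 / 4"
proof -
  \<comment> \<open>Dropping the zero term at \<open>j = 0\<close> makes the index set invariant
    under the reflection.\<close>
  have "(\<Sum>j<N. real j * (sin (real j * t))\<^sup>2) = (\<Sum>j=1..<N. real j * (sin (real j * t))\<^sup>2)"
    by (intro sum.mono_neutral_right) (auto simp: not_le)
  also have "\<dots> = (\<Sum>j=1..<N. real (N - j) * (sin (real (N - j) * t))\<^sup>2)"
    by (rule sum.reindex_bij_witness[of _ "\<lambda>j. N - j" "\<lambda>j. N - j"]) auto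
  also have "\<dots> = (\<Sum>j=1..<N. real N * (sin (real j * t))\<^sup>2 - real j * (sin (real j * t))\<^sup>2)"
  proof (rule sum.cong[OF refl])
    fix j assume "j \<in> {1..<N}"
    then have "real (N - j) = real N - real j" by simp
    moreover have "sin ((real N - real j) * t) = sin (real j * t)"
    proof -
      have "(real N - real j) * t = pi - real j * t"
        using N by (simp add: t field_simps)
      then show ?thesis by (simp add: sin_diff)
    qed
    ultimately show "real (N - j) * (sin (real (N - j) * t))\<^sup>2
        = real N * (sin (real j * t))\<^sup>2 - real j * (sin (real j * t))\<^sup>2"
      by (simp add: algebra_simps)
  qed
  also have "\<dots> = (\<Sum>j<N. real N * (sin (real j * t))\<^sup>2 - real j * (sin (real j * t))\<^sup>2)"
    by (intro sum.mono_neutral_left) (auto simp: not_le)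
  also have "\<dots> = real N * (real N / 2) - (\<Sum>j<N. real j * (sin (real j * t))\<^sup>2)"
    by (simp add: sum_subtractf sum_sin_squared flip: sum_distrib_left)
  finally show ?thesis by (simp add: power2_eq_square)
qed

text \<open>Multiply the eigenvalue equation \<open>s (j + 1) + s (j - 1) = 2 cos t s j\<close> by
  \<open>s j\<close> and sum: every neighbour product then occurs twice.\<close>

lemma sum_sin_consecutive: "(\<Sum>j<N. sin (real j * t) * sin (real (Suc j) * t)) = real N / 2 * cos t"
proof -
  let ?s = "\<lambda>j. sin (real j * t)"
  have last: "?s N = 0" using N by (simp add: t)
  \<comment> \<open>The last product of the range is met only once, hence the correction; it
    vanishes at \<open>n = N\<close> because \<open>?s N = 0\<close>.\<close>
  have r: "(\<Sum>j<n. ?s (Suc j) * ?s j + (if j = 0 then 0 else ?s j * ?s (j - 1)))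
      = 2 * (\<Sum>j<n. ?s j * ?s (Suc j)) - (if n = 0 then 0 else ?s n * ?s (n - 1))" for n
    by (induction n) (auto simp: algebra_simps)
  have "?s (Suc j) * ?s j + (if j = 0 then 0 else ?s j * ?s (j - 1)) = 2 * cos t * (?s j)\<^sup>2" for j
  proof (cases j)
    case (Suc i)
    then have "real (j - 1) * t = real j * t - t" "real (Suc j) * t = real j * t + t"
      by (auto simp: algebra_simps)
    with Suc show ?thesis
      by (simp only: sin_add sin_diff) (simp add: algebra_simps power2_eq_square)
  qed simp
  then have "2 * (\<Sum>j<N. ?s j * ?s (Suc j)) = 2 * cos t * (\<Sum>j<N. (?s j)\<^sup>2)"
    using r[of N] last by (simp add: sum_distrib_left)
  then show ?thesis unfolding sum_sin_squared by (simp add: mult.commute del: of_nat_Suc)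
qed
end

section \<open>The sine polynomial and its variances\<close>

definition thread_freq :: "int ^ 'd \<Rightarrow> int ^ 'd \<Rightarrow> nat \<Rightarrow> int ^ 'd" where
  "thread_freq k L j = k + int (j - 1) *s L"

text \<open>The factor \<open>r\<close> covers both \<open>p_min\<close> and its normalization. The
  range omits 0 and \<open>N\<close>, where the sine vanishes, so sums extend freely to
  \<open>j < N\<close>.\<close>

definition sine_sum :: "int ^ 'd \<Rightarrow> int ^ 'd \<Rightarrow> nat \<Rightarrow> real \<Rightarrow> real ^ 'd \<Rightarrow> complex" where
  "sine_sum k L N r = trig_sum (thread_freq k L) (\<lambda>j. of_real (r * sin (real j * (pi / real N)))) {1..<N}"

lemma inj_on_thread_freq:
  fixes L :: "int ^ 'd"
  assumes "L \<noteq> 0"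
  shows "inj_on (thread_freq k L) {1..<N}"
  using assms by (auto simp: inj_on_def thread_freq_def int_scale_right_inject)

lemma thread_freq_eq: "j \<ge> 1 \<Longrightarrow> thread_freq k L j = k + (int j - 1) *s L"
  by (simp add: thread_freq_def of_nat_diff)

lemma p_min_eq_sine_sum: "p_min L m k = sine_sum k L (m + 2) 1"
proof -
  have "{1..<m + 2} = {1..m + 1}" by auto
  then show ?thesis
    unfolding sine_sum_def by (simp only:) (simp add: fun_eq_iff p_min_def trig_sum_def thread_freq_def mult.commute)
qed

lemma sine_sum_divide: "(\<lambda>x. sine_sum k L N 1 x / complex_of_real r) = sine_sum k L N (1 / r)"
  by (simp add: fun_eq_iff sine_sum_def trig_sum_def sum_divide_distrib)

lemma p_min_scaled_eq_sine_sum: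
  "(\<lambda>x. p_min L m k x / complex_of_real r) = sine_sum k L (m + 2) (1 / r)"
  unfolding p_min_eq_sine_sum sine_sum_divide ..

context
  fixes k L :: "int ^ 'd" and N :: nat and r t :: real
  assumes L: "L \<noteq> 0" and N: "N \<ge> 2" and t: "t = pi / real N"
begin

lemma cos_step_pos:
  assumes "N \<ge> 3"
  shows "cos t > 0"
proof (rule cos_gt_zero)
  have "pi / real N < pi / 2" using assms by (intro divide_strict_left_mono) auto
  then show "t > 0" "t < pi / 2" using assms by (auto simp: t)
qed

lemma sum_sin_squared_from_1: "(\<Sum>j=1..<N. g j * (sin (real j * t))\<^sup>2) = (\<Sum>j<N. g j * (sin (real j * t))\<^sup>2)"
  by (intro sum.mono_neutral_left) (auto simp: not_le)

lemma torus_norm_sine_sum: "(torus_norm (sine_sum k L N r))\<^sup>2 = r\<^sup>2 * (real N / 2)"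
  using sum_sin_squared_from_1[of "\<lambda>_. r\<^sup>2"] sum_sin_squared[OF N t] inj_on_thread_freq[OF L]
  by (simp add: sine_sum_def torus_norm_trig_sum power_mult_distrib flip: sum_distrib_left t del: of_real_mult)

text \<open>\<open>A_op\<close> moves position \<open>i\<close> to \<open>i + 1\<close>, so the
  double sum collapses to products of consecutive coefficients.\<close>

lemma torus_inner_A_op_sine_sum:
  "torus_inner (A_op L (sine_sum k L N r)) (sine_sum k L N r) = of_real (r\<^sup>2 * (real N / 2 * cos t))"
proof -
  let ?c = "\<lambda>j. r * sin (real j * t)"
  have step: "L + thread_freq k L i = thread_freq k L j \<longleftrightarrow> j = Suc i"
    if "i \<in> {1..<N}" "j \<in> {1..<N}" for i j
  proof -
    have "L + thread_freq k L i = k + int i *s L"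
      using that by (simp add: thread_freq_eq vec_eq_iff algebra_simps)
    moreover have "thread_freq k L j = k + (int j - 1) *s L"
      using that by (simp add: thread_freq_eq)
    ultimately have "L + thread_freq k L i = thread_freq k L j \<longleftrightarrow> int i = int j - 1"
      by (simp only: add_left_cancel int_scale_right_inject[OF L])
    then show ?thesis by auto
  qed
  \<comment> \<open>Position \<open>N - 1\<close> has no successor in the range; the zero at
    \<open>N\<close> supplies the missing term.\<close>
  have end0: "?c N = 0" using N by (simp add: t)
  have "torus_inner (A_op L (sine_sum k L N r)) (sine_sum k L N r)
      = (\<Sum>i=1..<N. \<Sum>j=1..<N. if j = Suc i then complex_of_real (?c i * ?c j) else 0)"
    unfolding sine_sum_def A_op_trig_sum
    by (subst torus_inner_trig_sum) (auto intro!: sum.cong simp: step t)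
  also have "\<dots> = (\<Sum>i=1..<N. complex_of_real (?c i * ?c (Suc i)))"
  proof (rule sum.cong[OF refl])
    fix i assume i: "i \<in> {1..<N}"
    show "(\<Sum>j=1..<N. if j = Suc i then complex_of_real (?c i * ?c j) else 0)
        = complex_of_real (?c i * ?c (Suc i))"
    proof (cases "Suc i = N")
      case True
      then have "?c (Suc i) = 0" using end0 by (simp only:)
      then show ?thesis using True by (simp only: sum.delta finite_atLeastLessThan) simp
    next
      case False
      then show ?thesis using i by (simp only: sum.delta finite_atLeastLessThan) simp
    qed
  qed
  also have "\<dots> = (\<Sum>i<N. complex_of_real (?c i * ?c (Suc i)))"
    by (intro sum.mono_neutral_left) (auto simp: not_le)
  also have "\<dots> = of_real (r\<^sup>2 * (\<Sum>j<N. sin (real j * t) * sin (real (Suc j) * t)))"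
    unfolding sum_distrib_left of_real_sum by (simp add: power2_eq_square mult_ac)
  finally show ?thesis unfolding sum_sin_consecutive[OF N t] .
qed

lemma var_A_sine_sum:
  assumes "N \<ge> 3" "r \<noteq> 0"
  shows "var_A L (sine_sum k L N r) = ereal ((tan t)\<^sup>2)"
proof -
  \<comment> \<open>\<open>R\<close> is the squared norm; it cancels, so the scale \<open>r\<close>
    does not affect the variance.\<close>
  define R where "R = r\<^sup>2 * (real N / 2)"
  define z where "z = torus_inner (A_op L (sine_sum k L N r)) (sine_sum k L N r)"
  have c: "cos t > 0" using assms(1) by (rule cos_step_pos)
  have R: "R > 0" using assms N by (simp add: R_def)
  have "torus_norm (sine_sum k L N r) ^ 4 = R\<^sup>2"
    unfolding R_def torus_norm_sine_sum[symmetric] by (simp flip: power_mult)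
  moreover have "z = of_real (R * cos t)"
    unfolding z_def torus_inner_A_op_sine_sum R_def by simp
  then have "cmod z = R * cos t" "z \<noteq> 0"
    using R c by (auto simp: norm_mult)
  ultimately have "var_A L (sine_sum k L N r) = ereal (R\<^sup>2 / (R * cos t)\<^sup>2 - 1)"
    by (simp add: var_A_def z_def[symmetric])
  also have "R\<^sup>2 / (R * cos t)\<^sup>2 - 1 = 1 / (cos t)\<^sup>2 - 1"
    using R by (simp add: power_mult_distrib)
  also have "\<dots> = (tan t)\<^sup>2"
    using tan_sec[of t] c by (simp add: inverse_eq_divide power_divide)
  finally show ?thesis .
qed

lemma var_F_sine_sum:
  assumes "r \<noteq> 0"
  shows "var_F L (sine_sum k L N r)
    = norm (real_vec L) ^ 4 * (((real N)\<^sup>2 - 4) / 12 - (cos t / sin t)\<^sup>2 / 2)"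
proof -
  let ?s2 = "\<lambda>j. (sin (real j * t))\<^sup>2" and ?f = "sine_sum k L N r"
  define b where "b = real_vec L \<bullet> real_vec L"
  \<comment> \<open>Positions start at 1, so the frequency \<open>k\<close> itself has value
    \<open>a + b\<close>.\<close>
  define a where "a = real_vec L \<bullet> real_vec k - b"
  have freq: "real_vec L \<bullet> real_vec (thread_freq k L j) = a + real j * b" if "j \<ge> 1" for j
  proof -
    have "real_vec (thread_freq k L j) = real_vec k + (real j - 1) *\<^sub>R real_vec L"
      using that by (simp add: thread_freq_eq real_vec_def vec_eq_iff left_diff_distrib)
    then show ?thesis by (simp only: a_def b_def inner_add_right inner_scaleR_right) (simp add: algebra_simps)
  qed
  have B: "B_op L ?f = trig_sum (thread_freq k L)
      (\<lambda>j. of_real (- (a + real j * b) * (r * sin (real j * t)))) {1..<N}"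
    unfolding sine_sum_def B_op_trig_sum
    by (auto simp: fun_eq_iff trig_sum_def freq t algebra_simps intro!: sum.cong)
  \<comment> \<open>Both the norm and the inner product of \<open>B_op L ?f\<close> are combinations
    of the moments of order 0, 1 and 2.\<close>
  have sums: "(\<Sum>j=1..<N. (x + y * real j + z * (real j)\<^sup>2) * ?s2 j)
      = x * (real N / 2) + y * ((real N)\<^sup>2 / 4)
        + z * (real N / 2 * (((real N)\<^sup>2 - 1) / 3 - (cos t / sin t)\<^sup>2 / 2))" for x y z
    unfolding sum_sin_squared_from_1 distrib_right sum.distrib
    by (simp only: mult.assoc sum_sin_squared[OF N t] sum_times_sin_squared[OF N t]
        sum_square_times_sin_squared[OF N t] flip: sum_distrib_left)
  have "(torus_norm (B_op L ?f))\<^sup>2 = (\<Sum>j=1..<N. r\<^sup>2 * ((a\<^sup>2 + 2 * a * b * real j + b\<^sup>2 * (real j)\<^sup>2) * ?s2 j))"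
    unfolding B using inj_on_thread_freq[OF L]
    by (simp only: torus_norm_trig_sum finite_atLeastLessThan norm_of_real power2_abs)
       (auto intro!: sum.cong simp: power2_eq_square algebra_simps)
  then have norm_B: "(torus_norm (B_op L ?f))\<^sup>2 = r\<^sup>2 * (a\<^sup>2 * (real N / 2) + 2 * a * b * ((real N)\<^sup>2 / 4)
        + b\<^sup>2 * (real N / 2 * (((real N)\<^sup>2 - 1) / 3 - (cos t / sin t)\<^sup>2 / 2)))"
    unfolding sum_distrib_left[symmetric] sums .
  \<comment> \<open>The zero quadratic term brings the summand into the shape of
    \<open>sums\<close>.\<close>
  have "torus_inner (B_op L ?f) ?f
      = (\<Sum>j=1..<N. complex_of_real (- r\<^sup>2 * ((a + b * real j + 0 * (real j)\<^sup>2) * ?s2 j)))"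
    unfolding B unfolding sine_sum_def t[symmetric] using inj_on_thread_freq[OF L]
    by (simp only: torus_inner_trig_sum_same finite_atLeastLessThan complex_cnj_complex_of_real
        of_real_mult[symmetric])
       (simp add: power2_eq_square algebra_simps)
  also have "\<dots> = of_real (- r\<^sup>2 * (a * (real N / 2) + b * ((real N)\<^sup>2 / 4)))"
    unfolding of_real_sum[symmetric] sum_distrib_left[symmetric] sums by simp
  finally have inner_B: "(cmod (torus_inner (B_op L ?f) ?f))\<^sup>2
      = (r\<^sup>2 * (a * (real N / 2) + b * ((real N)\<^sup>2 / 4)))\<^sup>2"
    by (simp only: norm_of_real power2_abs) simp
  have n4: "torus_norm ?f ^ 4 = (r\<^sup>2 * (real N / 2))\<^sup>2"
    unfolding torus_norm_sine_sum[symmetric] by (simp flip: power_mult)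
  have b2: "b\<^sup>2 = norm (real_vec L) ^ 4"
    by (simp add: b_def dot_square_norm flip: power_mult)
  have "var_F L ?f = b\<^sup>2 * (((real N)\<^sup>2 - 4) / 12 - (cos t / sin t)\<^sup>2 / 2)"
  proof -
    \<comment> \<open>\<open>R\<close> is the squared norm and \<open>V\<close> the normalized
      second moment of the position. The mean is \<open>N / 2\<close>, so the variance is
      \<open>V - N\<^sup>2 / 4\<close>.\<close>
    define R V where "R = r\<^sup>2 * (real N / 2)" and "V = ((real N)\<^sup>2 - 1) / 3 - (cos t / sin t)\<^sup>2 / 2"
    have "R \<noteq> 0" using assms N by (simp add: R_def)
    have "var_F L ?f = R * (a\<^sup>2 + a * b * real N + b\<^sup>2 * V) / R - (R * (a + b * (real N / 2)))\<^sup>2 / R\<^sup>2"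
    proof -
      have "r\<^sup>2 * (a\<^sup>2 * (real N / 2) + 2 * a * b * ((real N)\<^sup>2 / 4) + b\<^sup>2 * (real N / 2 * V))
          = R * (a\<^sup>2 + a * b * real N + b\<^sup>2 * V)"
        by (simp add: R_def power2_eq_square algebra_simps)
      moreover have "r\<^sup>2 * (a * (real N / 2) + b * ((real N)\<^sup>2 / 4)) = R * (a + b * (real N / 2))"
        by (simp add: R_def power2_eq_square algebra_simps)
      ultimately show ?thesis
        unfolding var_F_def norm_B inner_B n4 torus_norm_sine_sum V_def[symmetric] R_def[symmetric]
        by (simp only:)
    qed
    also have "\<dots> = (a\<^sup>2 + a * b * real N + b\<^sup>2 * V) - (a + b * (real N / 2))\<^sup>2"
      using \<open>R \<noteq> 0\<close> by (simp add: power_mult_distrib)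
    also have "\<dots> = b\<^sup>2 * (V - (real N)\<^sup>2 / 4)"
      by (simp add: power2_eq_square algebra_simps)
    also have "V - (real N)\<^sup>2 / 4 = ((real N)\<^sup>2 - 4) / 12 - (cos t / sin t)\<^sup>2 / 2"
      by (simp add: V_def field_simps)
    finally show ?thesis .
  qed
  then show ?thesis by (simp only: b2)
qed

text \<open>The powers of the norm of \<open>L\<close> cancel, and \<open>tan t\<close> times
  \<open>cot t\<close> is 1, which leaves the constant \<open>- 1 / 2\<close>.\<close>

lemma UP_sine_sum:
  assumes "N \<ge> 3" "r \<noteq> 0"
  shows "UP L (sine_sum k L N r) = ereal (((real N)\<^sup>2 - 4) / 12 * (tan t)\<^sup>2 - 1 / 2)"
proof -
  have "norm (real_vec L) \<noteq> 0"
    using L by (auto simp: real_vec_def vec_eq_iff)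
  moreover have "cos t > 0" using assms(1) by (rule cos_step_pos)
  then have "(tan t)\<^sup>2 * (cos t / sin t)\<^sup>2 = 1"
    using sin_step_pos[OF N t] by (simp add: tan_def field_simps)
  ultimately show ?thesis
    unfolding UP_def var_A_sine_sum[OF assms] var_F_sine_sum[OF assms(2)]
    by (simp add: algebra_simps)
qed

end

section \<open>Assembly of bound and minimizer\<close>

theorem theorem4:
  fixes L :: "int ^ 'd" and S :: "(int ^ 'd) set" and m\<^sub>0 :: nat
  assumes "L \<noteq> 0"
    and "finite S"
    and "\<exists>T. longest_thread S L T \<and> card T = m\<^sub>0 + 1"
    and "m\<^sub>0 \<ge> 1"
  shows
    "(\<exists>p. is_arg_min (var_A L) (\<lambda>p. p \<in> trig_poly S \<and> torus_norm p = 1) p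
          \<and> var_A L p = ereal ((tan (pi / real (m\<^sub>0 + 2)))\<^sup>2))
     \<and> (\<forall>k\<^sub>0. longest_thread S L (progression k\<^sub>0 L m\<^sub>0) \<longrightarrow>
          p_min L m\<^sub>0 k\<^sub>0 \<in> trig_poly S
          \<and> (\<forall>j\<in>{1..m\<^sub>0 + 1}. fourier_coeff (p_min L m\<^sub>0 k\<^sub>0) (k\<^sub>0 + int (j - 1) *s L)
                 = complex_of_real (sin (pi * real j / real (m\<^sub>0 + 2))))
          \<and> (\<forall>k. k \<notin> progression k\<^sub>0 L m\<^sub>0 \<longrightarrow> fourier_coeff (p_min L m\<^sub>0 k\<^sub>0) k = 0)
          \<and> is_arg_min (var_A L) (\<lambda>p. p \<in> trig_poly S \<and> torus_norm p = 1)
              (\<lambda>x. p_min L m\<^sub>0 k\<^sub>0 x / complex_of_real (torus_norm (p_min L m\<^sub>0 k\<^sub>0)))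
          \<and> UP L (p_min L m\<^sub>0 k\<^sub>0)
              = ereal (real m\<^sub>0 * (real m\<^sub>0 + 4) / 12 * (tan (pi / real (m\<^sub>0 + 2)))\<^sup>2 - 1 / 2))"
proof -
  let ?N = "m\<^sub>0 + 2" and ?t = "pi / real (m\<^sub>0 + 2)"
  let ?q = "\<lambda>k\<^sub>0 x. p_min L m\<^sub>0 k\<^sub>0 x / complex_of_real (torus_norm (p_min L m\<^sub>0 k\<^sub>0))"
  obtain T where T: "longest_thread S L T" "card T = m\<^sub>0 + 1"
    using assms(3) by blast
  \<comment> \<open>The lower bound counts elements of threads, so its parameter is
    \<open>m\<^sub>0 + 1\<close> and its angle is \<open>?t\<close>.\<close>
  have lower: "ereal ((tan ?t)\<^sup>2) \<le> var_A L p" if "p \<in> trig_poly S" "torus_norm p = 1" for p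
    using var_A_lower_bound[OF assms(2,1) _ _ that, of "m\<^sub>0 + 1"] T assms(4)
    by (auto simp: longest_thread_def)
  have sub: "thread_freq k\<^sub>0 L ` {1..<?N} = progression k\<^sub>0 L m\<^sub>0" for k\<^sub>0
  proof -
    have "{0..m\<^sub>0} = (\<lambda>j. j - 1) ` {1..<?N}" by (auto simp: image_iff intro!: bexI[of _ "Suc _"])
    then show ?thesis by (auto simp: progression_def thread_freq_def image_image)
  qed
  have in_S: "sine_sum k\<^sub>0 L ?N r \<in> trig_poly S" if "longest_thread S L (progression k\<^sub>0 L m\<^sub>0)" for k\<^sub>0 r
    unfolding sine_sum_def using that assms(2) sub[of k\<^sub>0]
    by (intro trig_sum_in_trig_poly) (auto simp: longest_thread_def thread_def)
  have q: "is_arg_min (var_A L) (\<lambda>p. p \<in> trig_poly S \<and> torus_norm p = 1) (?q k\<^sub>0)"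
      "var_A L (?q k\<^sub>0) = ereal ((tan ?t)\<^sup>2)"
    if lt: "longest_thread S L (progression k\<^sub>0 L m\<^sub>0)" for k\<^sub>0
  proof -
    let ?n = "torus_norm (p_min L m\<^sub>0 k\<^sub>0)"
    have n2: "?n\<^sup>2 = real ?N / 2"
      using torus_norm_sine_sum[OF assms(1) _ refl, of ?N k\<^sub>0 1] by (simp add: p_min_eq_sine_sum)
    then have "?n \<noteq> 0" by auto
    have "(torus_norm (?q k\<^sub>0))\<^sup>2 = 1"
      using torus_norm_sine_sum[OF assms(1) _ refl, of ?N k\<^sub>0 "1 / ?n"] n2
      by (simp add: p_min_scaled_eq_sine_sum power_divide)
    moreover have "torus_norm (?q k\<^sub>0) \<ge> 0"
      unfolding torus_norm_def torus_integral_def set_lebesgue_integral_def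
      by (intro real_sqrt_ge_zero integral_nonneg_AE) simp
    ultimately have "torus_norm (?q k\<^sub>0) = 1" by (simp add: power2_eq_1_iff)
    moreover show v: "var_A L (?q k\<^sub>0) = ereal ((tan ?t)\<^sup>2)"
      unfolding p_min_scaled_eq_sine_sum
      by (rule var_A_sine_sum[OF assms(1) _ refl]) (use assms(4) \<open>?n \<noteq> 0\<close> in auto)
    moreover have "?q k\<^sub>0 \<in> trig_poly S"
      unfolding p_min_scaled_eq_sine_sum by (rule in_S[OF lt])
    ultimately show "is_arg_min (var_A L) (\<lambda>p. p \<in> trig_poly S \<and> torus_norm p = 1) (?q k\<^sub>0)"
      using lower by (auto simp: is_arg_min_def not_less)
  qed
  \<comment> \<open>The existence claim needs a starting point of some longest thread; the
    cardinality of \<open>T\<close> forces \<open>m = m\<^sub>0\<close>.\<close>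
  obtain k\<^sub>0 m where "T = progression k\<^sub>0 L m"
    using T(1) by (auto simp: longest_thread_def thread_def)
  then have "longest_thread S L (progression k\<^sub>0 L m\<^sub>0)"
    using T assms(1) by (simp add: card_progression)
  from q[OF this] show ?thesis
  proof (intro conjI allI impI ballI exI[of _ "?q k\<^sub>0"], goal_cases)
    case (3 k)
    then show ?case unfolding p_min_eq_sine_sum by (intro in_S)
  next
    case (4 k j)
    then have j: "j \<in> {1..<?N}" by auto
    have "{i \<in> {1..<?N}. thread_freq k L i = thread_freq k L j} = {j}"
      using inj_on_thread_freq[OF assms(1), of k ?N] j by (auto dest: inj_onD)
    then have "fourier_coeff (sine_sum k L ?N 1) (thread_freq k L j) = complex_of_real (sin (real j * ?t))"
      by (simp add: sine_sum_def fourier_coeff_trig_sum)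
    then show ?case by (simp add: p_min_eq_sine_sum thread_freq_def mult.commute)
  next
    case (5 k l)
    then have "{i \<in> {1..<?N}. thread_freq k L i = l} = {}"
      unfolding sub[symmetric] by auto
    then show ?case
      unfolding p_min_eq_sine_sum sine_sum_def by (simp only: fourier_coeff_trig_sum finite_atLeastLessThan) simp
  next
    case (7 k)
    have "UP L (sine_sum k L ?N 1) = ereal (((real ?N)\<^sup>2 - 4) / 12 * (tan ?t)\<^sup>2 - 1 / 2)"
      by (rule UP_sine_sum[OF assms(1) _ refl]) (use assms(4) in auto)
    moreover have "(real ?N)\<^sup>2 - 4 = real m\<^sub>0 * (real m\<^sub>0 + 4)"
      by (simp add: power2_eq_square algebra_simps)
    ultimately show ?case by (simp add: p_min_eq_sine_sum)
  qed (use q in auto)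
qed

end
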